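(* Let $s\in(0,1)$, let $\Omega\subset\mathbb{R}^n$ be a domain, and let $f\in L^2(\Omega)$ and $g\in L^1(\mathbb{R}^n\setminus\Omega)$. Let $I:H^s_{\Omega,g}\to\mathbb{R}$ be the functional defined by $$I[u]:=\frac{c_{n,s}}{4}\int_{\mathbb{R}^{2n}\setminus(\mathcal{C}\Omega)^2}\frac{|u(x)-u(y)|^2}{|x-y|^{n+2s}}\,dx\,dy-\int_\Omega f\,u-\int_{\mathbb{R}^n\setminus\Omega}g\,u$$ for every $u\in H^s_{\Omega,g}$. Then any critical point of $I$ is a weak solution of $$(-\Delta)^su=f\ \text{ in }\Omega,\qquad \mathcal{N}_su=g\ \text{ in }\mathbb{R}^n\setminus\overline{\Omega}.$$
   Context: A domain is a nonempty open set. $\mathcal{C}\Omega=\mathbb{R}^n\setminus\Omega$ and $(\mathcal{C}\Omega)^2=\mathcal{C}\Omega\times\mathcal{C}\Omega$. $c_{n,s}=\left(\int_{\mathbb{R}^n}\frac{1-\cos\zeta_1}{|\zeta|^{n+2s}}\,d\zeta\right)^{-1}$ is the normalization constant of the fractional Laplacian $(-\Delta)^su(x)=c_{n,s}\,\mathrm{PV}\int_{\mathbb{R}^n}\frac{u(x)-u(y)}{|x-y|^{n+2s}}\,dy$, and $\mathcal{N}_su(x)=c_{n,s}\int_\Omega\frac{u(x)-u(y)}{|x-y|^{n+2s}}\,dy$ for $x\in\mathbb{R}^n\setminus\overline\Omega$. For $g\in L^1(\mathbb{R}^n\setminus\Omega)$, $H^s_{\Omega,g}$ is the space of measurable $u:\mathbb{R}^n\to\mathbb{R}$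 (modulo a.e. equality) with $$\|u\|_{H^s_{\Omega,g}}^2=\|u\|_{L^2(\Omega)}^2+\||g|^{1/2}u\|_{L^2(\mathbb{R}^n\setminus\Omega)}^2+\int_{\mathbb{R}^{2n}\setminus(\mathcal{C}\Omega)^2}\frac{|u(x)-u(y)|^2}{|x-y|^{n+2s}}\,dx\,dy<\infty,$$ and $H^s_{\Omega,0}$ is this space for $g\equiv0$. A critical point of $I$ is $u\in H^s_{\Omega,g}$ with $\lim_{\epsilon\to0}\frac{I[u+\epsilon v]-I[u]}{\epsilon}=0$ for all $v\in H^s_{\Omega,g}$. Weak solution: $u\in H^s_{\Omega,0}$ is a weak solution of the problem if $$\frac{c_{n,s}}{2}\int_{\mathbb{R}^{2n}\setminus(\mathcal{C}\Omega)^2}\frac{(u(x)-u(y))(v(x)-v(y))}{|x-y|^{n+2s}}\,dx\,dy=\int_\Omega f\,v+\int_{\mathbb{R}^n\setminus\Omega}g\,v$$ for all $v\in H^s_{\Omega,g}$. *)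

theory Defs
  imports "HOL-Analysis.Analysis"
begin

text \<open>
  The type \<open>'n\<close> has no distinguished first element, so the coordinate \<open>\<zeta>\<^sub>1\<close> is an explicit
  parameter \<open>k\<close>; by rotational invariance the value does not depend on it.
\<close>

definition frac_const :: "'n::finite \<Rightarrow> real \<Rightarrow> real" where
  "frac_const k s =
     inverse (LINT \<zeta>::real^'n|lebesgue. (1 - cos (\<zeta> $ k)) / norm \<zeta> powr (real CARD('n) + 2 * s))"

definition off_compl_sq :: "(real^'n) set \<Rightarrow> ((real^'n) \<times> (real^'n)) set" where
  "off_compl_sq \<Omega> = UNIV - (UNIV - \<Omega>) \<times> (UNIV - \<Omega>)"

definition Hs_norm_sq :: "real \<Rightarrow> (real^'n::finite) set \<Rightarrow> (real^'n \<Rightarrow> real) \<Rightarrow> (real^'n \<Rightarrow> real) \<Rightarrow> ennreal"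
  where
  "Hs_norm_sq s \<Omega> g u =
     (\<integral>\<^sup>+x\<in>\<Omega>. ennreal ((u x)\<^sup>2) \<partial>lebesgue) +
     (\<integral>\<^sup>+x\<in>UNIV - \<Omega>. ennreal ((sqrt \<bar>g x\<bar> * u x)\<^sup>2) \<partial>lebesgue) +
     (\<integral>\<^sup>+z\<in>off_compl_sq \<Omega>.
        (case z of (x, y) \<Rightarrow>
          ennreal (\<bar>u x - u y\<bar>\<^sup>2 / norm (x - y) powr (real CARD('n) + 2 * s))) \<partial>lebesgue)"

text \<open>
  Elements are represented by functions rather than by classes modulo a.e. equality; everything
  below is invariant under changing a function on a null set. The weight \<open>g\<close> only
  matters outside \<open>\<Omega>\<close>.
\<close>

definition Hs :: "real \<Rightarrow> (real^'n::finite) set \<Rightarrow> (real^'n \<Rightarrow> real) \<Rightarrow> (real^'n \<Rightarrow> real) set" where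
  "Hs s \<Omega> g = {u. u \<in> borel_measurable lebesgue \<and> Hs_norm_sq s \<Omega> g u < \<infinity>}"

definition energy ::
  "'n::finite \<Rightarrow> real \<Rightarrow> (real^'n) set \<Rightarrow> (real^'n \<Rightarrow> real) \<Rightarrow> (real^'n \<Rightarrow> real) \<Rightarrow> (real^'n \<Rightarrow> real) \<Rightarrow> real"
  where
  "energy k s \<Omega> f g u =
     frac_const k s / 4 *
       (LINT z:off_compl_sq \<Omega>|lebesgue.
          (case z of (x, y) \<Rightarrow> \<bar>u x - u y\<bar>\<^sup>2 / norm (x - y) powr (real CARD('n) + 2 * s)))
     - (LINT x:\<Omega>|lebesgue. f x * u x)
     - (LINT x:UNIV - \<Omega>|lebesgue. g x * u x)"

definition critical_point ::
  "('a \<Rightarrow> real) set \<Rightarrow> (('a \<Rightarrow> real) \<Rightarrow> real) \<Rightarrow> ('a \<Rightarrow> real) \<Rightarrow> bool" where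
  "critical_point H J u \<longleftrightarrow>
     u \<in> H \<and>
     (\<forall>v\<in>H. ((\<lambda>\<epsilon>::real. (J (\<lambda>x. u x + \<epsilon> * v x) - J u) / \<epsilon>) \<longlongrightarrow> 0) (at 0))"

text \<open>
  Weak solutions of \<open>(-\<Delta>)\<^sup>s u = f\<close> in \<open>\<Omega>\<close>, \<open>\<N>\<^sub>s u = g\<close> in the complement of the closure of
  \<open>\<Omega>\<close>. Note the different weights: the solution lies in the space for weight \<open>0\<close>, the test
  functions in the space for weight \<open>g\<close>.
\<close>

definition weak_solution ::
  "'n::finite \<Rightarrow> real \<Rightarrow> (real^'n) set \<Rightarrow> (real^'n \<Rightarrow> real) \<Rightarrow> (real^'n \<Rightarrow> real) \<Rightarrow> (real^'n \<Rightarrow> real) \<Rightarrow> bool"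
  where
  "weak_solution k s \<Omega> f g u \<longleftrightarrow>
     u \<in> Hs s \<Omega> (\<lambda>_. 0) \<and>
     (\<forall>v\<in>Hs s \<Omega> g.
        frac_const k s / 2 *
          (LINT z:off_compl_sq \<Omega>|lebesgue.
             (case z of (x, y) \<Rightarrow>
               (u x - u y) * (v x - v y) / norm (x - y) powr (real CARD('n) + 2 * s)))
        = (LINT x:\<Omega>|lebesgue. f x * v x) + (LINT x:UNIV - \<Omega>|lebesgue. g x * v x))"

end

theory Submission
  imports Defs
begin

text \<open>
  The energy is a quadratic form minus a linear form, and all the integrals involved converge
  absolutely on the space (by \<open>2\<bar>ab\<bar> \<le> a\<^sup>2 + b\<^sup>2\<close>; for the exterior term,
  \<open>\<bar>g v\<bar> \<le> \<bar>g\<bar> + \<bar>g\<bar> v\<^sup>2\<close>). Hence the difference quotient in direction \<open>v\<close> is affine in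
  \<open>\<epsilon>\<close>, and its constant term, which vanishes at a critical point, is the difference of the two
  sides of the weak formulation.
\<close>

section \<open>Lebesgue measurability of the coordinate projections\<close>

text \<open>Elements of \<open>Hs\<close> are only Lebesgue measurable, so composing them with a
  projection requires the completed sigma-algebra on the target as well. This reduces to null sets:
  the preimage of a null set \<open>N\<close> is the cylinder \<open>N \<times> UNIV\<close>, which
  is null in the product.\<close>

lemma measurable_lebesgue_fst:
  "fst \<in> (lebesgue :: ('a::euclidean_space \<times> 'b::euclidean_space) measure) \<rightarrow>\<^sub>M lebesgue"
proof -
  have fst: "fst \<in> (lebesgue :: ('a \<times> 'b) measure) \<rightarrow>\<^sub>M lborel"
    by (intro measurable_completion)
      (simp add: borel_measurable_continuous_onI continuous_on_fst)
  have "N \<in> null_sets (distr (lebesgue :: ('a \<times> 'b) measure) lborel fst)"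
    if "N \<in> null_sets lborel" for N :: "'a set"
  proof -
    have "N \<times> (UNIV :: 'b set) \<in> null_sets (lborel \<Otimes>\<^sub>M lborel)"
      using that by (intro lborel.times_in_null_sets1) auto
    then show ?thesis
      using that fst null_setsD2[OF that]
      by (simp add: null_sets_distr_iff lborel_prod null_sets_completionI vimage_fst)
  qed
  then show ?thesis
    by (intro completion.measurable_completion2 fst) blast
qed

lemma measurable_lebesgue_snd:
  "snd \<in> (lebesgue :: ('a::euclidean_space \<times> 'b::euclidean_space) measure) \<rightarrow>\<^sub>M lebesgue"
proof -
  have snd: "snd \<in> (lebesgue :: ('a \<times> 'b) measure) \<rightarrow>\<^sub>M lborel"
    by (intro measurable_completion)
      (simp add: borel_measurable_continuous_onI continuous_on_snd)
  have "N \<in> null_sets (distr (lebesgue :: ('a \<times> 'b) measure) lborel snd)"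
    if "N \<in> null_sets lborel" for N :: "'b set"
  proof -
    have "(UNIV :: 'a set) \<times> N \<in> null_sets (lborel \<Otimes>\<^sub>M lborel)"
      using that by (intro lborel.times_in_null_sets2) auto
    then show ?thesis
      using that snd null_setsD2[OF that]
      by (simp add: null_sets_distr_iff lborel_prod null_sets_completionI vimage_snd)
  qed
  then show ?thesis
    by (intro completion.measurable_completion2 snd) blast
qed

text \<open>A Cauchy-Schwarz substitute that serves all three terms of the energy: the weight
  \<open>w\<close> is the kernel, the indicator of \<Omega>, or \<bar>g\<bar> cut off to the
  complement of \<Omega>.\<close>

lemma integrable_weighted_product:
  fixes w a b :: "'a \<Rightarrow> real"
  assumes [measurable]: "w \<in> borel_measurable M" "a \<in> borel_measurable M" "b \<in> borel_measurable M"
    and "\<And>x. 0 \<le> w x"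
    and "integrable M (\<lambda>x. w x * (a x)\<^sup>2)" "integrable M (\<lambda>x. w x * (b x)\<^sup>2)"
  shows "integrable M (\<lambda>x. w x * (a x * b x))"
proof (rule Bochner_Integration.integrable_bound)
  show "integrable M (\<lambda>x. w x * (a x)\<^sup>2 + w x * (b x)\<^sup>2)"
    using assms by simp
  show "AE x in M. norm (w x * (a x * b x)) \<le> norm (w x * (a x)\<^sup>2 + w x * (b x)\<^sup>2)"
  proof (rule AE_I2)
    fix x
    have "2 * (\<bar>a x\<bar> * \<bar>b x\<bar>) \<le> (a x)\<^sup>2 + (b x)\<^sup>2"
      using sum_squares_bound[of "\<bar>a x\<bar>" "\<bar>b x\<bar>"] by simp
    \<comment> \<open>This allows the factor 2 in the preceding bound to be dropped.\<close>
    moreover have "0 \<le> \<bar>a x\<bar> * \<bar>b x\<bar>"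
      by simp
    ultimately have "\<bar>a x * b x\<bar> \<le> (a x)\<^sup>2 + (b x)\<^sup>2"
      by (simp only: abs_mult)
    then have "w x * \<bar>a x * b x\<bar> \<le> w x * ((a x)\<^sup>2 + (b x)\<^sup>2)"
      using assms(4) by (rule mult_left_mono)
    then show "norm (w x * (a x * b x)) \<le> norm (w x * (a x)\<^sup>2 + w x * (b x)\<^sup>2)"
      using assms(4)[of x] by (simp add: abs_mult distrib_left)
  qed
qed simp

section \<open>The Gagliardo form as a weighted integral over the product space\<close>

text \<open>Absorbing the indicator turns set integrals into plain integrals against one nonnegative
  weight. On the diagonal the denominator is \<open>0 powr _ = 0\<close>, and division by zero makes
  the value 0.\<close>

definition kernel :: "real \<Rightarrow> (real^'n::finite) set \<Rightarrow> (real^'n) \<times> (real^'n) \<Rightarrow> real" where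
  "kernel s \<Omega> z =
     indicator (off_compl_sq \<Omega>) z / norm (fst z - snd z) powr (real CARD('n) + 2 * s)"

definition increment :: "('a \<Rightarrow> real) \<Rightarrow> 'a \<times> 'a \<Rightarrow> real" where
  "increment u z = u (fst z) - u (snd z)"

lemma kernel_nonneg: "0 \<le> kernel s \<Omega> z"
  by (simp add: kernel_def)

lemma off_compl_sq_borel: "open \<Omega> \<Longrightarrow> off_compl_sq \<Omega> \<in> sets borel"
  unfolding off_compl_sq_def
  by (intro sets.Diff borel_closed closed_Times) (auto simp: closed_def)

lemma kernel_measurable:
  assumes "open \<Omega>"
  shows "kernel s \<Omega> \<in> borel_measurable lebesgue"
proof -
  have [measurable]: "off_compl_sq \<Omega> \<in> sets (borel \<Otimes>\<^sub>M borel)"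
    unfolding borel_prod using assms by (rule off_compl_sq_borel)
  have "kernel s \<Omega> \<in> borel_measurable (borel \<Otimes>\<^sub>M borel)"
    unfolding kernel_def by measurable
  then have "kernel s \<Omega> \<in> borel_measurable borel"
    unfolding borel_prod .
  then show ?thesis
    by (simp add: measurable_completion)
qed

lemma increment_measurable:
  fixes u :: "'a::euclidean_space \<Rightarrow> real"
  assumes "u \<in> borel_measurable lebesgue"
  shows "increment u \<in> borel_measurable lebesgue"
  unfolding increment_def
  using measurable_compose[OF measurable_lebesgue_fst assms]
    measurable_compose[OF measurable_lebesgue_snd assms]
  by (rule borel_measurable_diff)

section \<open>Integrability on \<open>Hs\<close>\<close>

lemma Hs_measurable: "u \<in> Hs s \<Omega> g \<Longrightarrow> u \<in> borel_measurable lebesgue"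
  by (simp add: Hs_def)

text \<open>\<open>Hs_norm_sq\<close> is a sum of three terms in \<open>ennreal\<close>, so its
  finiteness forces each term to be finite. This lemma and the next two read off Bochner
  integrability from one term each.\<close>

lemma Hs_square_integrable:
  assumes "open \<Omega>" "u \<in> Hs s \<Omega> g"
  shows "integrable lebesgue (\<lambda>x. indicator \<Omega> x * (u x)\<^sup>2)"
proof (rule integrableI_bounded)
  have [measurable]: "u \<in> borel_measurable lebesgue" "\<Omega> \<in> sets lebesgue"
    using assms by (auto simp: Hs_def)
  show "(\<lambda>x. indicator \<Omega> x * (u x)\<^sup>2) \<in> borel_measurable lebesgue"
    by measurable
  have "(\<integral>\<^sup>+x. ennreal (norm (indicator \<Omega> x * (u x)\<^sup>2)) \<partial>lebesgue)
      = (\<integral>\<^sup>+x\<in>\<Omega>. ennreal ((u x)\<^sup>2) \<partial>lebesgue)"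
    by (intro nn_integral_cong) (auto split: split_indicator)
  also have "\<dots> < \<infinity>"
    using assms by (simp add: Hs_def Hs_norm_sq_def less_top)
  finally show "(\<integral>\<^sup>+x. ennreal (norm (indicator \<Omega> x * (u x)\<^sup>2)) \<partial>lebesgue) < \<infinity>" .
qed

text \<open>The cutoff stays attached to \<open>g\<close> because only the product
  \<open>indicator (UNIV - \<Omega>) x * g x\<close> is known to be measurable.\<close>

lemma Hs_exterior_square_integrable:
  assumes "open \<Omega>" "set_integrable lebesgue (UNIV - \<Omega>) g" "u \<in> Hs s \<Omega> g"
  shows "integrable lebesgue (\<lambda>x. \<bar>indicator (UNIV - \<Omega>) x * g x\<bar> * (u x)\<^sup>2)"
proof (rule integrableI_bounded)
  have [measurable]: "u \<in> borel_measurable lebesgue"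
      "(\<lambda>x. indicator (UNIV - \<Omega>) x * g x) \<in> borel_measurable lebesgue"
    using assms by (auto simp: Hs_def set_integrable_def)
  show "(\<lambda>x. \<bar>indicator (UNIV - \<Omega>) x * g x\<bar> * (u x)\<^sup>2) \<in> borel_measurable lebesgue"
    by measurable
  have "(\<integral>\<^sup>+x. ennreal (norm (\<bar>indicator (UNIV - \<Omega>) x * g x\<bar> * (u x)\<^sup>2)) \<partial>lebesgue)
      = (\<integral>\<^sup>+x\<in>UNIV - \<Omega>. ennreal ((sqrt \<bar>g x\<bar> * u x)\<^sup>2) \<partial>lebesgue)"
    by (intro nn_integral_cong)
      (auto simp: abs_mult power_mult_distrib split: split_indicator)
  also have "\<dots> < \<infinity>"
    using assms by (simp add: Hs_def Hs_norm_sq_def less_top)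
  finally show
    "(\<integral>\<^sup>+x. ennreal (norm (\<bar>indicator (UNIV - \<Omega>) x * g x\<bar> * (u x)\<^sup>2)) \<partial>lebesgue) < \<infinity>" .
qed

lemma Hs_increment_square_integrable:
  fixes u :: "real^'n::finite \<Rightarrow> real"
  assumes "open \<Omega>" "u \<in> Hs s \<Omega> g"
  shows "integrable lebesgue (\<lambda>z. kernel s \<Omega> z * (increment u z)\<^sup>2)"
proof (rule integrableI_bounded)
  have [measurable]: "increment u \<in> borel_measurable lebesgue"
      "kernel s \<Omega> \<in> borel_measurable lebesgue"
    using assms by (auto intro: Hs_measurable increment_measurable kernel_measurable)
  show "(\<lambda>z. kernel s \<Omega> z * (increment u z)\<^sup>2) \<in> borel_measurable lebesgue"
    by measurable
  have "(\<integral>\<^sup>+z. ennreal (norm (kernel s \<Omega> z * (increment u z)\<^sup>2)) \<partial>lebesgue)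
      = (\<integral>\<^sup>+z\<in>off_compl_sq \<Omega>. (case z of (x, y) \<Rightarrow>
          ennreal (\<bar>u x - u y\<bar>\<^sup>2 / norm (x - y) powr (real CARD('n) + 2 * s))) \<partial>lebesgue)"
    by (intro nn_integral_cong) (auto simp: kernel_def increment_def split: split_indicator)
  also have "\<dots> < \<infinity>"
    using assms by (simp add: Hs_def Hs_norm_sq_def less_top)
  finally show
    "(\<integral>\<^sup>+z. ennreal (norm (kernel s \<Omega> z * (increment u z)\<^sup>2)) \<partial>lebesgue) < \<infinity>" .
qed

lemma Hs_increment_product_integrable:
  assumes "open \<Omega>" "u \<in> Hs s \<Omega> g" "v \<in> Hs s \<Omega> g"
  shows "integrable lebesgue (\<lambda>z. kernel s \<Omega> z * (increment u z * increment v z))"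
  using assms
  by (intro integrable_weighted_product kernel_nonneg kernel_measurable increment_measurable
      Hs_increment_square_integrable Hs_measurable)

lemma Hs_interior_load_integrable:
  assumes "open \<Omega>" "set_borel_measurable lebesgue \<Omega> f" "set_integrable lebesgue \<Omega> (\<lambda>x. (f x)\<^sup>2)"
    and "v \<in> Hs s \<Omega> g"
  shows "set_integrable lebesgue \<Omega> (\<lambda>x. f x * v x)"
proof -
  \<comment> \<open>The outer indicator is the weight; the inner one makes the factor containing
    \<open>f\<close> measurable, since nothing is assumed about \<open>f\<close> outside
    \<Omega>.\<close>
  have "integrable lebesgue (\<lambda>x. indicator \<Omega> x * ((indicator \<Omega> x * f x) * v x))"
  proof (rule integrable_weighted_product)
    show "integrable lebesgue (\<lambda>x. indicator \<Omega> x * (indicator \<Omega> x * f x)\<^sup>2)"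
      using assms(3) unfolding set_integrable_def
      by (rule Bochner_Integration.integrable_cong[THEN iffD1, rotated -1])
        (auto split: split_indicator)
    show "integrable lebesgue (\<lambda>x. indicator \<Omega> x * (v x)\<^sup>2)"
      using assms(1,4) by (rule Hs_square_integrable)
    show "(indicator \<Omega> :: _ \<Rightarrow> real) \<in> borel_measurable lebesgue"
      using assms(1) by (intro borel_measurable_indicator) auto
  qed (use assms in \<open>auto simp: set_borel_measurable_def Hs_def\<close>)
  then show ?thesis
    unfolding set_integrable_def
    by (rule Bochner_Integration.integrable_cong[THEN iffD1, rotated -1])
      (auto split: split_indicator)
qed

lemma Hs_exterior_load_integrable:
  assumes "open \<Omega>" "set_integrable lebesgue (UNIV - \<Omega>) g" "v \<in> Hs s \<Omega> g"
  shows "set_integrable lebesgue (UNIV - \<Omega>) (\<lambda>x. g x * v x)"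
proof -
  have g: "integrable lebesgue (\<lambda>x. indicator (UNIV - \<Omega>) x * g x)"
    using assms(2) by (simp add: set_integrable_def)
  then have [measurable]: "(\<lambda>x. indicator (UNIV - \<Omega>) x * g x) \<in> borel_measurable lebesgue"
    by auto
  have [measurable]: "v \<in> borel_measurable lebesgue"
    using assms(3) by (rule Hs_measurable)
  \<comment> \<open>With the constant 1 as one factor, its weighted square is \<bar>g\<bar> itself,
    so integrability of \<open>g\<close> supplies the first premise and the weighted term of the
    norm the second.\<close>
  have int: "integrable lebesgue (\<lambda>x. \<bar>indicator (UNIV - \<Omega>) x * g x\<bar> * (1 * v x))"
  proof (rule integrable_weighted_product)
    show "integrable lebesgue (\<lambda>x. \<bar>indicator (UNIV - \<Omega>) x * g x\<bar> * 1\<^sup>2)"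
      using integrable_abs[OF g] by simp
    show "integrable lebesgue (\<lambda>x. \<bar>indicator (UNIV - \<Omega>) x * g x\<bar> * (v x)\<^sup>2)"
      using assms by (rule Hs_exterior_square_integrable)
  qed auto
  \<comment> \<open>Restoring the sign of \<open>g\<close> leaves the norm of the integrand
    unchanged.\<close>
  have "integrable lebesgue (\<lambda>x. (indicator (UNIV - \<Omega>) x * g x) * v x)"
    by (rule Bochner_Integration.integrable_bound[OF int]) (auto simp: abs_mult)
  then show ?thesis
    unfolding set_integrable_def by (simp add: mult.assoc)
qed

section \<open>Expansion of the energy along a line\<close>

text \<open>The integrands agree at every point, including the diagonal, where both are 0.\<close>

lemma energy_eq:
  fixes u :: "real^'n::finite \<Rightarrow> real"
  shows "energy k s \<Omega> f g u =
    frac_const k s / 4 * (LINT z|lebesgue. kernel s \<Omega> z * (increment u z)\<^sup>2)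
    - (LINT x:\<Omega>|lebesgue. f x * u x) - (LINT x:UNIV - \<Omega>|lebesgue. g x * u x)"
proof -
  have "(LINT z:off_compl_sq \<Omega>|lebesgue. (case z of (x, y) \<Rightarrow>
          \<bar>u x - u y\<bar>\<^sup>2 / norm (x - y) powr (real CARD('n) + 2 * s)))
      = (LINT z|lebesgue. kernel s \<Omega> z * (increment u z)\<^sup>2)"
    unfolding set_lebesgue_integral_def
    by (intro Bochner_Integration.integral_cong) (auto simp: kernel_def increment_def)
  then show ?thesis
    by (simp add: energy_def)
qed

text \<open>An exact second-order expansion: the cross term of the square carries a factor 2, which
  turns the 1/4 of the energy into the 1/2 of the weak formulation. The integrability lemmas justify
  splitting the integrals.\<close>

lemma energy_add_scaled:
  fixes u v f g :: "real^'n::finite \<Rightarrow> real"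
  assumes "open \<Omega>"
    and f: "set_borel_measurable lebesgue \<Omega> f" "set_integrable lebesgue \<Omega> (\<lambda>x. (f x)\<^sup>2)"
    and g: "set_integrable lebesgue (UNIV - \<Omega>) g"
    and u: "u \<in> Hs s \<Omega> g" and v: "v \<in> Hs s \<Omega> g"
  shows "energy k s \<Omega> f g (\<lambda>x. u x + \<epsilon> * v x) = energy k s \<Omega> f g u
    + \<epsilon> * (frac_const k s / 2 *
          (LINT z|lebesgue. kernel s \<Omega> z * (increment u z * increment v z))
        - (LINT x:\<Omega>|lebesgue. f x * v x) - (LINT x:UNIV - \<Omega>|lebesgue. g x * v x))
    + \<epsilon>\<^sup>2 * (frac_const k s / 4 * (LINT z|lebesgue. kernel s \<Omega> z * (increment v z)\<^sup>2))"
proof -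
  let ?K = "kernel s \<Omega>"
  have "(LINT z|lebesgue. ?K z * (increment (\<lambda>x. u x + \<epsilon> * v x) z)\<^sup>2)
      = (LINT z|lebesgue. ?K z * (increment u z)\<^sup>2
          + 2 * \<epsilon> * (?K z * (increment u z * increment v z)) + \<epsilon>\<^sup>2 * (?K z * (increment v z)\<^sup>2))"
    by (intro Bochner_Integration.integral_cong)
      (auto simp: increment_def algebra_simps power2_eq_square)
  also have "\<dots> = (LINT z|lebesgue. ?K z * (increment u z)\<^sup>2)
      + 2 * \<epsilon> * (LINT z|lebesgue. ?K z * (increment u z * increment v z))
      + \<epsilon>\<^sup>2 * (LINT z|lebesgue. ?K z * (increment v z)\<^sup>2)"
    using Hs_increment_square_integrable[OF assms(1) u] Hs_increment_square_integrable[OF assms(1) v]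
      Hs_increment_product_integrable[OF assms(1) u v]
    by simp
  finally have quadratic: "(LINT z|lebesgue. ?K z * (increment (\<lambda>x. u x + \<epsilon> * v x) z)\<^sup>2) = \<dots>" .
  \<comment> \<open>Generic in the set and the coefficient, so as to cover both the interior load
    \<open>f\<close> and the exterior load \<open>g\<close>.\<close>
  have linear: "(LINT x:A|lebesgue. h x * (u x + \<epsilon> * v x))
      = (LINT x:A|lebesgue. h x * u x) + \<epsilon> * (LINT x:A|lebesgue. h x * v x)"
    if "set_integrable lebesgue A (\<lambda>x. h x * u x)" "set_integrable lebesgue A (\<lambda>x. h x * v x)"
    for A :: "(real^'n) set" and h
  proof -
    have "(LINT x:A|lebesgue. h x * (u x + \<epsilon> * v x))
        = (LINT x:A|lebesgue. h x * u x + \<epsilon> * (h x * v x))"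
      by (simp add: algebra_simps)
    then show ?thesis
      using that by (simp add: set_integral_add(2))
  qed
  show ?thesis
    unfolding energy_eq quadratic
      linear[OF Hs_interior_load_integrable[OF assms(1) f u]
        Hs_interior_load_integrable[OF assms(1) f v]]
      linear[OF Hs_exterior_load_integrable[OF assms(1) g u]
        Hs_exterior_load_integrable[OF assms(1) g v]]
    by (simp add: field_simps)
qed

text \<open>Weight 0 removes the exterior term, which can only decrease the norm. This bridges the
  space of critical points and the space in which weak solutions are sought.\<close>

lemma Hs_subset_Hs_zero: "Hs s \<Omega> g \<subseteq> Hs s \<Omega> (\<lambda>_. 0)"
  by (auto simp: Hs_def Hs_norm_sq_def)

theorem proposition3p7:
  fixes k :: "'n::finite" and s :: real and \<Omega> :: "(real^'n) set"
    and f g u :: "real^'n \<Rightarrow> real"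
  assumes "0 < s" and "s < 1"
    and "open \<Omega>" and "\<Omega> \<noteq> {}"
    and "set_borel_measurable lebesgue \<Omega> f"
    and "set_integrable lebesgue \<Omega> (\<lambda>x. (f x)\<^sup>2)"
    and "set_integrable lebesgue (UNIV - \<Omega>) g"
    and "critical_point (Hs s \<Omega> g) (energy k s \<Omega> f g) u"
  shows "weak_solution k s \<Omega> f g u"
  unfolding weak_solution_def
proof (intro conjI ballI)
  have u: "u \<in> Hs s \<Omega> g"
    using assms(8) by (simp add: critical_point_def)
  then show "u \<in> Hs s \<Omega> (\<lambda>_. 0)"
    using Hs_subset_Hs_zero by blast
  fix v assume v: "v \<in> Hs s \<Omega> g"
  let ?B = "LINT z|lebesgue. kernel s \<Omega> z * (increment u z * increment v z)"
  let ?L = "(LINT x:\<Omega>|lebesgue. f x * v x) + (LINT x:UNIV - \<Omega>|lebesgue. g x * v x)"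
  \<comment> \<open>\<open>a\<close> is the first variation at \<open>u\<close> in direction
    \<open>v\<close>, and \<open>b\<close> is the quadratic part of the energy evaluated at
    \<open>v\<close>.\<close>
  define a where "a = frac_const k s / 2 * ?B - ?L"
  define b where "b = frac_const k s / 4 * (LINT z|lebesgue. kernel s \<Omega> z * (increment v z)\<^sup>2)"
  have quotient:
    "(energy k s \<Omega> f g (\<lambda>x. u x + \<epsilon> * v x) - energy k s \<Omega> f g u) / \<epsilon> = a + \<epsilon> * b"
    if "\<epsilon> \<noteq> 0" for \<epsilon>
    using that unfolding energy_add_scaled[OF assms(3,5-7) u v] a_def b_def
    by (simp add: field_simps power2_eq_square)
  have "((\<lambda>\<epsilon>. (energy k s \<Omega> f g (\<lambda>x. u x + \<epsilon> * v x) - energy k s \<Omega> f g u) / \<epsilon>) \<longlongrightarrow> 0) (at 0)"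
    using assms(8) v by (simp add: critical_point_def)
  \<comment> \<open>The filter \<open>at 0\<close> ignores the point 0 itself, where the difference
    quotient takes the default value 0 instead of \<open>a\<close>.\<close>
  then have "((\<lambda>\<epsilon>. a + \<epsilon> * b) \<longlongrightarrow> 0) (at 0)"
    by (rule Lim_transform_eventually) (auto simp: eventually_at_filter quotient)
  moreover have "((\<lambda>\<epsilon>. a + \<epsilon> * b) \<longlongrightarrow> a + 0 * b) (at 0)"
    by (intro tendsto_intros)
  ultimately have "a = 0"
    using LIM_unique by fastforce
  moreover have "(LINT z:off_compl_sq \<Omega>|lebesgue. (case z of (x, y) \<Rightarrow>
      (u x - u y) * (v x - v y) / norm (x - y) powr (real CARD('n) + 2 * s))) = ?B"
    unfolding set_lebesgue_integral_def
    by (intro Bochner_Integration.integral_cong) (auto simp: kernel_def increment_def)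
  ultimately show "frac_const k s / 2 *
      (LINT z:off_compl_sq \<Omega>|lebesgue. (case z of (x, y) \<Rightarrow>
        (u x - u y) * (v x - v y) / norm (x - y) powr (real CARD('n) + 2 * s))) = ?L"
    by (simp add: a_def)
qed

end
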